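(* Set $\hbar=1$. On the fixed-Williamson-frame radial manifold $$\mathcal M_{S_W}=\left\{S_W\Bigl(\bigoplus_{k=1}^N\nu_k\mathbb 1_2\Bigr)S_W^{\mathsf T}:\nu_k>\tfrac12\right\},$$ with Euler field $V=\sum_{k=1}^N\nu_k\partial_{\nu_k}$ and entropy $S=\sum_{k=1}^Ns(\nu_k)$, one has $$V(S)=S+\Phi,\qquad \Phi(\nu_1,\dots,\nu_N)=-\frac12\sum_{k=1}^N\log\left(\nu_k^2-\frac14\right).$$
   Context: $S_W$ is a fixed symplectic matrix: $S_W\Omega S_W^{\mathsf T}=\Omega$ with $\Omega=\bigoplus_{k=1}^N\begin{pmatrix}0&1\\-1&0\end{pmatrix}$. $\mathcal M_{S_W}$ is coordinatized by $(\nu_1,\dots,\nu_N)\in(1/2,\infty)^N$. The entropy of one Gaussian normal mode is $s(\nu)=\left(\nu+\frac12\right)\log\left(\nu+\frac12\right)-\left(\nu-\frac12\right)\log\left(\nu-\frac12\right)$, with natural logarithm. *)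

theory Defs
  imports "HOL-Analysis.Analysis"
begin

text \<open>
  The \<open>N\<close> modes are indexed by a finite type \<open>'n\<close>, and the pair \<open>(k, a)\<close> is the
  \<open>a\<close>-th quadrature of mode \<open>k\<close>. Hence phase-space matrices are
  \<open>2N \<times> 2N\<close> matrices indexed by \<open>'n \<times> 2\<close>.
\<close>

type_synonym 'n phase_matrix = "real ^ ('n \<times> 2) ^ ('n \<times> 2)"

definition direct_sum :: "('n::finite \<Rightarrow> real ^ 2 ^ 2) \<Rightarrow> 'n phase_matrix" where
  "direct_sum B = (\<chi> p q. if fst p = fst q then B (fst p) $ snd p $ snd q else 0)"

definition Omega :: "('n::finite) phase_matrix" where
  "Omega = direct_sum (\<lambda>k. vector [vector [0, 1], vector [-1, 0]])"

definition symplectic :: "('n::finite) phase_matrix \<Rightarrow> bool" where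
  "symplectic S \<longleftrightarrow> S ** Omega ** transpose S = Omega"

definition coord_domain :: "(real ^ 'n::finite) set" where
  "coord_domain = {\<nu>. \<forall>k. \<nu> $ k > 1 / 2}"

definition williamson :: "('n::finite) phase_matrix \<Rightarrow> real ^ 'n \<Rightarrow> 'n phase_matrix" where
  "williamson S \<nu> = S ** direct_sum (\<lambda>k. (\<nu> $ k) *\<^sub>R mat 1) ** transpose S"

definition radial_manifold :: "('n::finite) phase_matrix \<Rightarrow> 'n phase_matrix set" where
  "radial_manifold S = williamson S ` coord_domain"

definition coords :: "('n::finite) phase_matrix \<Rightarrow> 'n phase_matrix \<Rightarrow> real ^ 'n" where
  "coords S = inv_into coord_domain (williamson S)"

text \<open>
  Scalar fields on the manifold are represented by functions on all matrices, of which
  only the values on the manifold matter: the \<open>k\<close>-th coordinate vector field differentiates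
  such a field along the curve on which only the coordinate \<open>\<nu>\<^sub>k\<close> varies.
\<close>

definition coord_field ::
    "('n::finite) phase_matrix \<Rightarrow> 'n \<Rightarrow> ('n phase_matrix \<Rightarrow> real) \<Rightarrow> 'n phase_matrix \<Rightarrow> real" where
  "coord_field S k F \<sigma> =
     deriv (\<lambda>t. F (williamson S (\<chi> j. if j = k then t else coords S \<sigma> $ j))) (coords S \<sigma> $ k)"

definition euler_field ::
    "('n::finite) phase_matrix \<Rightarrow> ('n phase_matrix \<Rightarrow> real) \<Rightarrow> 'n phase_matrix \<Rightarrow> real" where
  "euler_field S F \<sigma> = (\<Sum>k\<in>UNIV. coords S \<sigma> $ k * coord_field S k F \<sigma>)"

definition mode_entropy :: "real \<Rightarrow> real" where
  "mode_entropy \<nu> = (\<nu> + 1/2) * ln (\<nu> + 1/2) - (\<nu> - 1/2) * ln (\<nu> - 1/2)"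

definition entropy :: "('n::finite) phase_matrix \<Rightarrow> 'n phase_matrix \<Rightarrow> real" where
  "entropy S \<sigma> = (\<Sum>k\<in>UNIV. mode_entropy (coords S \<sigma> $ k))"

definition Phi :: "real ^ 'n::finite \<Rightarrow> real" where
  "Phi \<nu> = - (1/2) * (\<Sum>k\<in>UNIV. ln ((\<nu> $ k)\<^sup>2 - 1/4))"

text \<open>
  For symplectic \<open>S\<close> the \<open>\<nu>\<^sub>k\<close> are global coordinates on the manifold, so that the
  inverse chosen in the definition of \<^const>\<open>coords\<close> is the unique one.
\<close>

lemma Omega_square: "Omega ** Omega = (- mat 1 :: ('n::finite) phase_matrix)"
proof -
  have "(\<Sum>q\<in>UNIV. (Omega :: 'n phase_matrix) $ p $ q * Omega $ q $ r) = - (mat 1 $ p $ r)" for p r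
  proof -
    obtain k a l b where p: "p = (k, a)" and r: "r = (l, b)" by (metis surj_pair)
    have "(\<Sum>q\<in>UNIV. (Omega :: 'n phase_matrix) $ p $ q * Omega $ q $ r)
        = (\<Sum>i\<in>UNIV. \<Sum>c\<in>UNIV. (Omega :: 'n phase_matrix) $ p $ (i, c) * Omega $ (i, c) $ r)"
      by (simp add: sum.cartesian_product flip: UNIV_Times_UNIV)
    also have "\<dots> = (\<Sum>i\<in>UNIV. if i = k then
        (\<Sum>c\<in>UNIV. (Omega :: 'n phase_matrix) $ p $ (k, c) * Omega $ (k, c) $ r) else 0)"
      by (rule sum.cong) (auto simp: Omega_def direct_sum_def p)
    also have "\<dots> = (\<Sum>c\<in>UNIV. (Omega :: 'n phase_matrix) $ p $ (k, c) * Omega $ (k, c) $ r)"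
      by simp
    also have "\<dots> = - (mat 1 $ p $ r)"
      using exhaust_2[of a] exhaust_2[of b]
      by (auto simp: Omega_def direct_sum_def p r sum_2 mat_def)
    finally show ?thesis .
  qed
  then show ?thesis
    by (simp add: vec_eq_iff matrix_matrix_mult_def)
qed

lemma symplectic_left_inverse:
  fixes S :: "('a::finite) phase_matrix"
  assumes "symplectic S"
  obtains L where "L ** S = mat 1"
proof -
  have neg: "A ** (- B) = - (A ** B)" for A B :: "'a phase_matrix"
    by (simp add: matrix_matrix_mult_def vec_eq_iff sum_negf)
  have "S ** (Omega ** transpose S ** (- Omega)) = S ** Omega ** transpose S ** (- Omega)"
    by (simp only: matrix_mul_assoc)
  also have "\<dots> = mat 1"
    using assms unfolding symplectic_def by (simp add: neg Omega_square)
  finally have "S ** (Omega ** transpose S ** (- Omega)) = mat 1" .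
  then show thesis
    using that matrix_left_right_inverse by blast
qed

lemma inj_williamson:
  assumes "symplectic S"
  shows "inj (williamson S)"
proof (rule injI)
  fix \<mu> \<nu>
  assume eq: "williamson S \<mu> = williamson S \<nu>"
  obtain L where L: "L ** S = mat 1"
    using symplectic_left_inverse[OF assms] .
  then have R: "transpose S ** transpose L = mat 1"
    by (metis matrix_transpose_mul transpose_mat)
  have "L ** (S ** X ** transpose S) ** transpose L = X" for X
    by (metis L R matrix_mul_assoc matrix_mul_lid matrix_mul_rid)
  then have D: "direct_sum (\<lambda>k. (\<mu> $ k) *\<^sub>R mat 1) = direct_sum (\<lambda>k. (\<nu> $ k) *\<^sub>R mat 1)"
    using eq unfolding williamson_def by metis
  have "\<mu> $ k = \<nu> $ k" for k
    using arg_cong[OF D, of "\<lambda>X. X $ (k, 1) $ (k, 1)"]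
    by (simp add: direct_sum_def mat_def)
  then show "\<mu> = \<nu>"
    by (simp add: vec_eq_iff)
qed

lemma coords_williamson:
  assumes "symplectic S" "\<nu> \<in> coord_domain"
  shows "coords S (williamson S \<nu>) = \<nu>"
  unfolding coords_def
  using inj_williamson[OF assms(1)] assms(2) by (simp add: inj_on_subset)

end

theory Submission
  imports Defs
begin

text \<open>
  In the coordinates the claim separates into the one-mode identity
  \<open>\<nu> s'(\<nu>) = s(\<nu>) - (ln (\<nu> + 1/2) + ln (\<nu> - 1/2)) / 2\<close>, where
  \<open>s'(\<nu>) = ln (\<nu> + 1/2) - ln (\<nu> - 1/2)\<close>, and the two logarithms on the right combine
  to \<open>ln (\<nu>\<^sup>2 - 1/4)\<close>.
\<close>

text \<open>The product rule leaves the constants +1 and -1 besides the logarithms, and they cancel.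
  The bound on \<open>x\<close> keeps both arguments of \<open>ln\<close> positive.\<close>

lemma has_real_derivative_mode_entropy:
  assumes "x > 1/2"
  shows "(mode_entropy has_real_derivative ln (x + 1/2) - ln (x - 1/2)) (at x)"
  unfolding mode_entropy_def using assms
  by (auto intro!: derivative_eq_intros)

lemma mode_entropy_euler:
  assumes "x > 1/2"
  shows "x * (ln (x + 1/2) - ln (x - 1/2)) = mode_entropy x - 1/2 * ln (x\<^sup>2 - 1/4)"
proof -
  have "x\<^sup>2 - 1/4 = (x + 1/2) * (x - 1/2)"
    by (simp add: power2_eq_square field_simps)
  then have "ln (x\<^sup>2 - 1/4) = ln (x + 1/2) + ln (x - 1/2)"
    using assms by (simp add: ln_mult)
  \<comment> \<open>Collecting \<open>mode_entropy x\<close> by the factors \<open>x\<close> and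
    \<open>1/2\<close> gives \<open>x\<close> times the difference of the two logarithms plus half
    their sum; the half-sum is what gets subtracted.\<close>
  then show ?thesis
    unfolding mode_entropy_def by (simp add: algebra_simps)
qed

text \<open>Entropy is additive over the modes, so along the curve that varies only the coordinate
  \<open>k\<close> all other summands stay constant.\<close>

lemma coord_field_entropy:
  fixes \<nu> :: "real ^ 'n::finite"
  assumes "symplectic S" "\<nu> \<in> coord_domain"
  shows "coord_field S k (entropy S) (williamson S \<nu>) = ln (\<nu> $ k + 1/2) - ln (\<nu> $ k - 1/2)"
proof -
  let ?E = "\<lambda>t. entropy S (williamson S (\<chi> j. if j = k then t else \<nu> $ j))"
  let ?D = "ln (\<nu> $ k + 1/2) - ln (\<nu> $ k - 1/2)"
  let ?rest = "\<Sum>j\<in>UNIV - {k}. mode_entropy (\<nu> $ j)"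
  have \<nu>: "\<nu> $ j > 1/2" for j
    using assms(2) by (simp add: coord_domain_def)
  have E: "?E t = mode_entropy t + ?rest" if "t \<in> {1/2<..}" for t
  proof -
    have "(\<chi> j. if j = k then t else \<nu> $ j) \<in> coord_domain"
      using that \<nu> by (simp add: coord_domain_def)
    then have "?E t = (\<Sum>j\<in>UNIV. mode_entropy (if j = k then t else \<nu> $ j))"
      by (simp add: entropy_def coords_williamson[OF assms(1)])
    also have "\<dots> = mode_entropy t + ?rest"
      by (subst sum.remove[of _ k]) auto
    finally show ?thesis .
  qed
  have "((\<lambda>t. mode_entropy t + ?rest) has_real_derivative ?D) (at (\<nu> $ k))"
    using has_real_derivative_mode_entropy[OF \<nu>[of k]]
    by (auto intro!: derivative_eq_intros)
  \<comment> \<open>The formula for \<open>?E\<close> is established only while the curve stays in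
    \<open>coord_domain\<close>. This suffices: differentiation is local, and the open half-line
    contains \<open>\<nu> $ k\<close>.\<close>
  then have "(?E has_real_derivative ?D) (at (\<nu> $ k))"
    by (rule has_field_derivative_transform_within_open[where S = "{1/2<..}"])
      (use \<nu> E in auto)
  then show ?thesis
    unfolding coord_field_def coords_williamson[OF assms] by (rule DERIV_imp_deriv)
qed

theorem proposition11:
  fixes S\<^sub>W :: "('n::finite) phase_matrix"
  assumes "symplectic S\<^sub>W"
  shows "\<forall>\<sigma>\<in>radial_manifold S\<^sub>W.
    euler_field S\<^sub>W (entropy S\<^sub>W) \<sigma> = entropy S\<^sub>W \<sigma> + Phi (coords S\<^sub>W \<sigma>)"
proof
  fix \<sigma>
  assume "\<sigma> \<in> radial_manifold S\<^sub>W"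
  \<comment> \<open>By injectivity of the parametrization, \<open>coords\<close> returns this very
    \<open>\<nu>\<close>, which reduces the claim to a sum over modes.\<close>
  then obtain \<nu> where \<sigma>: "\<sigma> = williamson S\<^sub>W \<nu>" and \<nu>: "\<nu> \<in> coord_domain"
    by (auto simp: radial_manifold_def)
  have "euler_field S\<^sub>W (entropy S\<^sub>W) \<sigma>
      = (\<Sum>k\<in>UNIV. \<nu> $ k * (ln (\<nu> $ k + 1/2) - ln (\<nu> $ k - 1/2)))"
    by (simp add: euler_field_def \<sigma> coords_williamson[OF assms \<nu>] coord_field_entropy[OF assms \<nu>])
  also have "\<dots> = (\<Sum>k\<in>UNIV. mode_entropy (\<nu> $ k) - 1/2 * ln ((\<nu> $ k)\<^sup>2 - 1/4))"
    using \<nu> by (intro sum.cong refl mode_entropy_euler) (simp add: coord_domain_def)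
  also have "\<dots> = entropy S\<^sub>W \<sigma> + Phi (coords S\<^sub>W \<sigma>)"
    by (simp add: entropy_def Phi_def \<sigma> coords_williamson[OF assms \<nu>] sum_subtractf sum_distrib_left
        flip: sum_negf)
  finally show "euler_field S\<^sub>W (entropy S\<^sub>W) \<sigma> = entropy S\<^sub>W \<sigma> + Phi (coords S\<^sub>W \<sigma>)" .
qed

end
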